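(* Let $(b_i)_{i\ge1}$ and $(d_j)_{j\ge1}$ be lacunary sequences in $(0,\infty)$ with ratios $q_1,q_2\in(0,1)$ respectively, with counting functions $I$ and $J$, and suppose $q:=\max(q_1,q_2)<\tfrac12$. For $W>0$ define $$E(W):=\#\Big\{(i,i',j,j'):\ i,i'\le I(W),\ j,j'\le J(W),\ \big|(b_i-b_{i'})+(d_j-d_{j'})\big|\le e^{-W}\Big\},$$ $$E^-(W):=\#\Big\{(i,i',j,j'):\ i,i'\le I(W),\ j,j'\le J(W),\ \big|(b_i-b_{i'})-(d_j-d_{j'})\big|\le e^{-W}\Big\}.$$ Then there is a constant $C=C(q)$, depending only on $q$, such that $$E(W)=E^-(W)\le C\,I(W)\,J(W)\qquad\text{for all }W>0.$$
   Context: A sequence $(b_i)_{i\ge1}\subset(0,\infty)$ is lacunary with ratio $q\in(0,1)$ if $b_{i+1}\le q\,b_i$ for all $i$. The counting functions are $I(W)=\#\{i:b_i\ge e^{-W}\}$ and $J(W)=\#\{j:d_j\ge e^{-W}\}$ for $W>0$. Indices are integers $\ge1$. *)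

theory Defs
  imports Complex_Main
begin

text \<open>Sequences are indexed by the integers \<open>\<ge> 1\<close>; the value at index \<open>0\<close> is left
  unconstrained and is never used.\<close>

definition lacunary :: "real \<Rightarrow> (nat \<Rightarrow> real) \<Rightarrow> bool" where
  "lacunary q b \<longleftrightarrow> 0 < q \<and> q < 1 \<and> (\<forall>i\<ge>1. 0 < b i) \<and> (\<forall>i\<ge>1. b (Suc i) \<le> q * b i)"

definition counting :: "(nat \<Rightarrow> real) \<Rightarrow> real \<Rightarrow> nat" where
  "counting b W = card {i. 1 \<le> i \<and> exp (- W) \<le> b i}"

definition energy_plus :: "(nat \<Rightarrow> real) \<Rightarrow> (nat \<Rightarrow> real) \<Rightarrow> real \<Rightarrow> nat" where
  "energy_plus b d W = card {(i, i', j, j').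
     i \<in> {1..counting b W} \<and> i' \<in> {1..counting b W} \<and>
     j \<in> {1..counting d W} \<and> j' \<in> {1..counting d W} \<and>
     \<bar>(b i - b i') + (d j - d j')\<bar> \<le> exp (- W)}"

definition energy_minus :: "(nat \<Rightarrow> real) \<Rightarrow> (nat \<Rightarrow> real) \<Rightarrow> real \<Rightarrow> nat" where
  "energy_minus b d W = card {(i, i', j, j').
     i \<in> {1..counting b W} \<and> i' \<in> {1..counting b W} \<and>
     j \<in> {1..counting d W} \<and> j' \<in> {1..counting d W} \<and>
     \<bar>(b i - b i') - (d j - d j')\<bar> \<le> exp (- W)}"

text \<open>The set counted by \<open>counting\<close> is finite for a lacunary sequence, so its \<open>card\<close> is the
  genuine cardinality.\<close>

lemma lacunary_le_geometric:
  assumes "lacunary q b"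
  shows "b (Suc n) \<le> q ^ n * b 1"
proof (induction n)
  case 0
  then show ?case by simp
next
  case (Suc n)
  have "b (Suc (Suc n)) \<le> q * b (Suc n)"
    using assms by (simp add: lacunary_def)
  also have "\<dots> \<le> q * (q ^ n * b 1)"
    using Suc assms by (intro mult_left_mono) (auto simp: lacunary_def)
  finally show ?case by (simp add: mult.assoc)
qed

lemma finite_counting_set:
  assumes "lacunary q b"
  shows "finite {i. 1 \<le> i \<and> exp (- W) \<le> b i}"
proof -
  have "(\<lambda>n. q ^ n * b 1) \<longlonglongrightarrow> 0 * b 1"
    using assms by (intro tendsto_mult LIMSEQ_power_zero tendsto_const) (auto simp: lacunary_def)
  then have "eventually (\<lambda>n. q ^ n * b 1 < exp (- W)) sequentially"
    by (intro order_tendstoD) auto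
  then obtain N where N: "\<And>n. n \<ge> N \<Longrightarrow> q ^ n * b 1 < exp (- W)"
    by (auto simp: eventually_sequentially)
  have "i \<le> N" if "1 \<le> i" "exp (- W) \<le> b i" for i
  proof (rule ccontr)
    assume "\<not> i \<le> N"
    then obtain n where n: "i = Suc n" "N \<le> n" by (cases i) auto
    then show False
      using lacunary_le_geometric[OF assms, of n] N[of n] that by simp
  qed
  then show ?thesis
    by (intro finite_subset[OF _ finite_atMost[of N]]) auto
qed

end

theory Submission
  imports Defs
begin

text \<open>
  Write \<open>w = exp (- W)\<close>. As the ratios are at most \<open>1/2\<close>, a window \<open>[x, 2\<^sup>k x)\<close> contains at most
  \<open>k\<close> terms of either sequence; hence at most two terms that are at least \<open>w\<close> lie within \<open>w\<close> of a
  given point, and any three entries of a solution leave at most two choices for the fourth. This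
  settles the solutions with \<open>i = i'\<close> or \<open>j = j'\<close>. For the others let \<open>m = min i i'\<close> and
  \<open>n = min j j'\<close>. The differences have sizes comparable to \<open>b m\<close> and \<open>d n\<close>, so these two numbers
  are within a factor \<open>4\<close> of each other, and \<open>m\<close> leaves at most five choices for \<open>n\<close>. Therefore
  the pair \<open>(m, max j j')\<close> determines \<open>n\<close>, and then \<open>max i i'\<close>, up to boundedly many choices.
\<close>

text \<open>Used below to project solutions to a pair of indices and bound the choices for the other
  coordinates.\<close>

lemma card_le_fibres:
  assumes "finite A" "f ` S \<subseteq> A"
    and fib: "\<And>a. a \<in> A \<Longrightarrow> card {x \<in> S. f x = a} \<le> k"
  shows "card S \<le> k * card A"
proof -
  have "S = (\<Union>a\<in>A. {x \<in> S. f x = a})"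
    using assms(2) by auto
  then have "card S \<le> (\<Sum>a\<in>A. card {x \<in> S. f x = a})"
    using card_UN_le[OF assms(1), of "\<lambda>a. {x \<in> S. f x = a}"] by simp
  also have "\<dots> \<le> card A * k"
    using sum_bounded_above[of A "\<lambda>a. card {x \<in> S. f x = a}" k] fib by simp
  finally show ?thesis by (simp add: mult.commute)
qed

lemma lacunary_pos: "lacunary q b \<Longrightarrow> 1 \<le> i \<Longrightarrow> 0 < b i"
  by (simp add: lacunary_def)

lemma lacunary_shift_le:
  assumes "lacunary q b" "q \<le> 1/2" "1 \<le> i"
  shows "2 ^ k * b (i + k) \<le> b i"
proof (induction k)
  case 0
  then show ?case by simp
next
  case (Suc k)
  have "b (Suc (i + k)) \<le> q * b (i + k)"
    using assms by (auto simp: lacunary_def)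
  also have "\<dots> \<le> 1/2 * b (i + k)"
    using assms lacunary_pos[OF assms(1), of "i + k"] by (intro mult_right_mono) auto
  finally have "2 ^ k * (2 * b (i + Suc k)) \<le> 2 ^ k * b (i + k)"
    by (intro mult_left_mono) auto
  also note Suc
  finally show ?case by (simp add: mult_ac)
qed

lemma lacunary_antimono:
  assumes "lacunary q b" "1 \<le> i" "i \<le> j"
  shows "b j \<le> b i"
  using assms(3)
proof (induction rule: dec_induct)
  case base
  then show ?case by simp
next
  case (step n)
  then have "0 < b n" "b (Suc n) \<le> q * b n" "q < 1"
    using assms by (auto simp: lacunary_def)
  then have "b (Suc n) \<le> b n"
    using mult_right_mono[of q 1 "b n"] by linarith
  with step show ?case by simp
qed

lemma lacunary_half_le:
  assumes "lacunary q b" "q \<le> 1/2" "1 \<le> i" "i < j"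
  shows "b j \<le> b i / 2"
  using lacunary_shift_le[OF assms(1-3), of 1] lacunary_antimono[OF assms(1), of "i + 1" j] assms
  by simp

text \<open>From the least index \<open>m\<close> in \<open>S\<close> on, \<open>k\<close> halvings
  bring the sequence to at most \<open>b m / 2 ^ k < x\<close>, so \<open>S\<close> lies in
  \<open>{m..<m + k}\<close>.\<close>

lemma card_window_le:
  assumes "lacunary q b" "q \<le> 1/2"
    and S: "\<And>i. i \<in> S \<Longrightarrow> 1 \<le> i \<and> x \<le> b i \<and> b i < 2 ^ k * x"
  shows "finite S \<and> card S \<le> k"
proof (cases "S = {}")
  case False
  define m where "m = (LEAST i. i \<in> S)"
  have m: "m \<in> S"
    unfolding m_def using False by (metis LeastI ex_in_conv)
  have "S \<subseteq> {m..<m + k}"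
  proof
    fix i assume i: "i \<in> S"
    then have "m \<le> i"
      unfolding m_def by (rule Least_le)
    moreover have "i < m + k"
    proof (rule ccontr)
      assume "\<not> i < m + k"
      then have "b i \<le> b (m + k)"
        using lacunary_antimono[OF assms(1), of "m + k" i] S[OF m] by simp
      then have "2 ^ k * x \<le> 2 ^ k * b (m + k)"
        using S[OF i] by simp
      also have "\<dots> \<le> b m"
        using lacunary_shift_le[OF assms(1,2)] S[OF m] by blast
      finally show False
        using S[OF m] by simp
    qed
    ultimately show "i \<in> {m..<m + k}" by simp
  qed
  then show ?thesis
    using card_mono[of "{m..<m + k}" S] finite_subset[of S] by simp
qed simp

text \<open>The terms lie between \<open>max w (x - w)\<close> and \<open>x + w\<close>. The upper
  end is at most three times the lower one, with equality at \<open>x = 2 * w\<close>, so two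
  halvings cover the window.\<close>

lemma card_near_le_2:
  assumes "lacunary q b" "q \<le> 1/2" "0 < w"
    and S: "\<And>i. i \<in> S \<Longrightarrow> 1 \<le> i \<and> w \<le> b i \<and> \<bar>b i - x\<bar> \<le> w"
  shows "card S \<le> 2"
proof -
  have "1 \<le> i \<and> max w (x - w) \<le> b i \<and> b i < 2 ^ 2 * max w (x - w)" if "i \<in> S" for i
    using S[OF that] \<open>0 < w\<close> by (auto simp: max_def abs_if split: if_splits)
  from card_window_le[OF assms(1,2) this] show ?thesis by blast
qed

text \<open>By monotonicity a term below the threshold at \<open>i\<close> confines all counted
  indices to \<open>{1..<i}\<close>, which has fewer than \<open>i\<close> elements.\<close>

lemma le_countingD:
  assumes "lacunary q b" "1 \<le> i" "i \<le> counting b W"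
  shows "exp (- W) \<le> b i"
proof (rule ccontr)
  assume *: "\<not> exp (- W) \<le> b i"
  have "{k. 1 \<le> k \<and> exp (- W) \<le> b k} \<subseteq> {1..<i}"
    using lacunary_antimono[OF assms(1,2)] * by (force simp: not_less[symmetric])
  then have "counting b W \<le> card {1..<i}"
    unfolding counting_def by (intro card_mono) auto
  with assms show False by simp
qed

text \<open>The term of larger index is positive and at most half of the other, so the other
  dominates the difference.\<close>

lemma lacunary_abs_diff:
  assumes "lacunary q b" "q \<le> 1/2" "1 \<le> i" "1 \<le> i'" "i \<noteq> i'"
  shows "b (min i i') / 2 \<le> \<bar>b i - b i'\<bar>" "\<bar>b i - b i'\<bar> \<le> b (min i i')"
proof -
  consider "i < i'" | "i' < i"
    using assms by linarith
  then have "b (min i i') / 2 \<le> \<bar>b i - b i'\<bar> \<and> \<bar>b i - b i'\<bar> \<le> b (min i i')"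
    using lacunary_half_le[OF assms(1,2), of i i'] lacunary_half_le[OF assms(1,2), of i' i]
      lacunary_pos[OF assms(1), of i] lacunary_pos[OF assms(1), of i'] assms(3,4)
    by cases (auto simp: min_def)
  then show "b (min i i') / 2 \<le> \<bar>b i - b i'\<bar>" "\<bar>b i - b i'\<bar> \<le> b (min i i')"
    by auto
qed

lemma energy_plus_le:
  assumes lb: "lacunary q1 b" "q1 \<le> 1/2" and ld: "lacunary q2 d" "q2 \<le> 1/2"
  shows "energy_plus b d W \<le> 44 * (counting b W * counting d W)"
proof -
  define w where "w = exp (- W)"
  define I where "I = {1..counting b W}"
  define J where "J = {1..counting d W}"
  have w: "0 < w" by (simp add: w_def)
  have I: "1 \<le> i" "w \<le> b i" if "i \<in> I" for i
    using le_countingD[OF lb(1)] that by (auto simp: I_def w_def)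
  have J: "1 \<le> j" "w \<le> d j" if "j \<in> J" for j
    using le_countingD[OF ld(1)] that by (auto simp: J_def w_def)
  define T where "T = {(i, i', j, j'). i \<in> I \<and> i' \<in> I \<and> j \<in> J \<and> j' \<in> J \<and>
     \<bar>(b i - b i') + (d j - d j')\<bar> \<le> w}"
  define T1 where "T1 = {(i, i', j, j') \<in> T. i = i'}"
  define T2 where "T2 = {(i, i', j, j') \<in> T. j = j'}"
  define T3 where "T3 = {(i, i', j, j') \<in> T. i \<noteq> i' \<and> j \<noteq> j'}"
  have fin: "finite (I \<times> J)" by (simp add: I_def J_def)

  have c1: "card T1 \<le> 2 * card (I \<times> J)"
  proof (rule card_le_fibres[where f = "\<lambda>(i, i', j, j'). (i, j)", OF fin])
    show "(\<lambda>(i, i', j, j'). (i, j)) ` T1 \<subseteq> I \<times> J"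
      by (auto simp: T1_def T_def)
    fix a assume "a \<in> I \<times> J"
    obtain i j where a: "a = (i, j)" by fastforce
    let ?F = "{x \<in> T1. (\<lambda>(i, i', j, j'). (i, j)) x = a}"
    \<comment> \<open>With \<open>i = i'\<close> the condition says that \<open>d j'\<close> is
      within \<open>w\<close> of \<open>d j\<close>.\<close>
    have "card ((\<lambda>(i, i', j, j'). j') ` ?F) \<le> 2"
      by (rule card_near_le_2[OF ld w, where x = "d j"])
        (auto simp: T1_def T_def a abs_minus_commute J[unfolded One_nat_def])
    moreover have "inj_on (\<lambda>(i, i', j, j'). j') ?F"
      by (auto simp: inj_on_def T1_def a)
    ultimately show "card ?F \<le> 2"
      by (simp add: card_image)
  qed

  have c2: "card T2 \<le> 2 * card (I \<times> J)"
  proof (rule card_le_fibres[where f = "\<lambda>(i, i', j, j'). (i, j)", OF fin])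
    show "(\<lambda>(i, i', j, j'). (i, j)) ` T2 \<subseteq> I \<times> J"
      by (auto simp: T2_def T_def)
    fix a assume "a \<in> I \<times> J"
    obtain i j where a: "a = (i, j)" by fastforce
    let ?F = "{x \<in> T2. (\<lambda>(i, i', j, j'). (i, j)) x = a}"
    have "card ((\<lambda>(i, i', j, j'). i') ` ?F) \<le> 2"
      by (rule card_near_le_2[OF lb w, where x = "b i"])
        (auto simp: T2_def T_def a abs_minus_commute I[unfolded One_nat_def])
    moreover have "inj_on (\<lambda>(i, i', j, j'). i') ?F"
      by (auto simp: inj_on_def T2_def a)
    ultimately show "card ?F \<le> 2"
      by (simp add: card_image)
  qed

  \<comment> \<open>40 = 2 * (2 * 2 * 5): two orderings, at most five values of
    \<open>min j j'\<close>, and at most two of \<open>max i i'\<close>.\<close>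
  have c3: "card T3 \<le> 40 * card (I \<times> J)"
  proof (rule card_le_fibres[where f = "\<lambda>(i, i', j, j'). (min i i', max j j')", OF fin])
    show "(\<lambda>(i, i', j, j'). (min i i', max j j')) ` T3 \<subseteq> I \<times> J"
      by (auto simp: T3_def T_def min_def max_def)
    fix a assume "a \<in> I \<times> J"
    obtain m N where a: "a = (m, N)" by fastforce
    let ?F = "{x \<in> T3. (\<lambda>(i, i', j, j'). (min i i', max j j')) x = a}"
    \<comment> \<open>The estimates give \<open>b m / 4 \<le> d n \<le> 4 * b m\<close>. The window
      is half-open, so the fifth doubling is there to include the right end.\<close>
    define R where "R = {n. 1 \<le> n \<and> b m / 4 \<le> d n \<and> d n < 2 ^ 5 * (b m / 4)}"
    have R: "finite R" "card R \<le> 5"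
      using card_window_le[OF ld, of R "b m / 4" 5] by (auto simp: R_def)
    let ?g = "\<lambda>(i, i', j, j'). (i < i', j < j', min j j')"
    have "card ?F \<le> 2 * card ((UNIV :: bool set) \<times> (UNIV :: bool set) \<times> R)"
    proof (rule card_le_fibres[where f = ?g])
      show "finite ((UNIV :: bool set) \<times> (UNIV :: bool set) \<times> R)"
        using R by simp
      show "?g ` ?F \<subseteq> UNIV \<times> UNIV \<times> R"
      proof
        fix y assume "y \<in> ?g ` ?F"
        then obtain i i' j j' where t: "(i, i', j, j') \<in> T3" and m: "min i i' = m"
          and y: "y = (i < i', j < j', min j j')"
          by (auto simp: a)
        have ij: "i \<in> I" "i' \<in> I" "j \<in> J" "j' \<in> J" "i \<noteq> i'" "j \<noteq> j'"
          and le: "\<bar>(b i - b i') + (d j - d j')\<bar> \<le> w"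
          using t by (auto simp: T3_def T_def)
        have n: "min j j' \<in> J" and "min i i' \<in> I"
          using ij by (auto simp: min_def)
        then have "w \<le> b m" "w \<le> d (min j j')"
          using I J m by auto
        moreover have "b m / 2 \<le> \<bar>b i - b i'\<bar>" "\<bar>b i - b i'\<bar> \<le> b m"
          using lacunary_abs_diff[OF lb, of i i'] ij I m by auto
        moreover have "d (min j j') / 2 \<le> \<bar>d j - d j'\<bar>" "\<bar>d j - d j'\<bar> \<le> d (min j j')"
          using lacunary_abs_diff[OF ld, of j j'] ij J by auto
        \<comment> \<open>The two differences differ in size by at most \<open>w\<close>, which is
          absorbed using \<open>w \<le> d (min j j')\<close> for the first bound and
          \<open>w \<le> b m\<close> for the second.\<close>
        ultimately have "b m / 4 \<le> d (min j j')" "d (min j j') < 8 * b m"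
          using le w by linarith+
        then show "y \<in> UNIV \<times> UNIV \<times> R"
          using J(1)[OF n] by (simp add: R_def y)
      qed
      fix c assume "c \<in> (UNIV :: bool set) \<times> (UNIV :: bool set) \<times> R"
      obtain s t n where c: "c = (s, t, n)" by (cases c)
      let ?G = "{x \<in> ?F. ?g x = c}"
      \<comment> \<open>The energy condition solved for \<open>b (max i i')\<close>:
        \<open>s\<close> decides on which side of \<open>b i - b i'\<close> this term stands,
        \<open>t\<close> fixes the sign of \<open>d j - d j'\<close>.\<close>
      define x where "x = (if s then b m + (if t then d n - d N else d N - d n)
                                 else b m - (if t then d n - d N else d N - d n))"
      have "card ((\<lambda>(i, i', j, j'). max i i') ` ?G) \<le> 2"
      proof (rule card_near_le_2[OF lb w, where x = x])
        fix k assume "k \<in> (\<lambda>(i, i', j, j'). max i i') ` ?G"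
        then obtain i i' j j' where t: "(i, i', j, j') \<in> T" "i \<noteq> i'" "j \<noteq> j'"
            and k: "k = max i i'" "min i i' = m" "max j j' = N" "(i < i') = s" "(j < j') = t"
              "min j j' = n"
          by (auto simp: T3_def a c)
        have "k \<in> I" using t k by (auto simp: T_def max_def)
        moreover have "\<bar>b k - x\<bar> \<le> w"
          using t k unfolding x_def T_def
          by (auto simp: max_def min_def abs_le_iff split: if_splits)
        ultimately show "1 \<le> k \<and> w \<le> b k \<and> \<bar>b k - x\<bar> \<le> w"
          using I by auto
      qed
      \<comment> \<open>Both minima and maxima together with the orderings \<open>s\<close> and
        \<open>t\<close> recover the quadruple.\<close>
      moreover have "inj_on (\<lambda>(i, i', j, j'). max i i') ?G"
        by (auto simp: inj_on_def a c T3_def min_def max_def split: if_splits)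
      ultimately show "card ?G \<le> 2"
        by (simp add: card_image)
    qed
    then show "card ?F \<le> 40"
      using R by (simp add: card_cartesian_product)
  qed

  have "T = T1 \<union> T2 \<union> T3"
    by (auto simp: T1_def T2_def T3_def)
  then have "card T \<le> card T1 + card T2 + card T3"
    using card_Un_le[of "T1 \<union> T2" T3] card_Un_le[of T1 T2] by simp
  also have "\<dots> \<le> 44 * card (I \<times> J)"
    using c1 c2 c3 by simp
  finally show ?thesis
    by (simp add: T_def I_def J_def w_def energy_plus_def card_cartesian_product)
qed

text \<open>Swapping \<open>j\<close> and \<open>j'\<close> reverses the sign of
  \<open>d j - d j'\<close> and is an involution.\<close>

lemma energy_plus_eq_minus: "energy_plus b d W = energy_minus b d W"
  unfolding energy_plus_def energy_minus_def
  by (rule bij_betw_same_card[where f = "\<lambda>(i, i', j, j'). (i, i', j', j)"],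
      rule bij_betw_byWitness[where f' = "\<lambda>(i, i', j, j'). (i, i', j', j)"])
    (auto simp: algebra_simps)

theorem lemma19:
  fixes q :: real
  assumes "0 < q" and "q < 1/2"
  shows "\<exists>C::real. \<forall>(b::nat \<Rightarrow> real) (d::nat \<Rightarrow> real) (q1::real) (q2::real).
           lacunary q1 b \<longrightarrow> lacunary q2 d \<longrightarrow> q = max q1 q2 \<longrightarrow>
           (\<forall>W>0. energy_plus b d W = energy_minus b d W \<and>
                  real (energy_plus b d W) \<le> C * real (counting b W) * real (counting d W))"
\<comment> \<open>The witness is the constant 44 = 2 + 2 + 40 of \<open>energy_plus_le\<close>; both
  ratios are below \<open>1/2\<close> because their maximum is.\<close>
proof (intro exI[of _ 44] allI impI conjI)
  fix b d :: "nat \<Rightarrow> real" and q1 q2 W :: real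
  assume "lacunary q1 b" "lacunary q2 d" "q = max q1 q2"
  then have "energy_plus b d W \<le> 44 * (counting b W * counting d W)"
    using assms by (intro energy_plus_le) auto
  then have "real (energy_plus b d W) \<le> real (44 * (counting b W * counting d W))"
    by (rule of_nat_mono)
  then show "real (energy_plus b d W) \<le> 44 * real (counting b W) * real (counting d W)"
    by simp
qed (rule energy_plus_eq_minus)

end
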